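(* Let $G=(V,E)$ be a finite simple graph without a connected component isomorphic to $K_2$. Then there exists an edge-weighting $\omega:E \rightarrow \{1,2,3,4\}$ such that for any two adjacent vertices $u$ and $v$, $$\sum_{w \in N(u)}\omega(\{u,w\}) \neq \sum_{w \in N(v)}\omega(\{v,w\}).$$
   Context: $N(v)$ denotes the neighborhood of a vertex $v$ in $G$. *)

theory Defs
  imports "Graph_Theory.Graph_Theory" "HOL-Library.FuncSet"
begin

text \<open>
  A finite simple graph is a \<^locale>\<open>pair_graph\<close>: a finite, loop-free, symmetric set of arcs,
  where the two arcs \<open>(u, v)\<close> and \<open>(v, u)\<close> together stand for one undirected edge. The edge set
  proper consists of the two-element sets \<open>{u, v}\<close>, so a function on it gives both arcs of an
  edge the same value.
\<close>

definition edges :: "'a pair_pre_digraph \<Rightarrow> 'a set set" where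
  "edges G = {{u, v} | u v. (u, v) \<in> parcs G}"

definition neighborhood :: "'a pair_pre_digraph \<Rightarrow> 'a \<Rightarrow> 'a set" where
  "neighborhood G v = {w. (v, w) \<in> parcs G}"

text \<open>
  In a symmetric digraph, strong connectivity and connectivity coincide, so the members of
  \<^term>\<open>pre_digraph.sccs (with_proj G)\<close> (induced subgraphs, not just vertex sets) are the connected
  components of \<open>G\<close>.
\<close>

abbreviation components :: "'a pair_pre_digraph \<Rightarrow> ('a, 'a \<times> 'a) pre_digraph set" where
  "components G \<equiv> pre_digraph.sccs (with_proj G)"

definition K2 :: "nat pair_pre_digraph" where
  "K2 = \<lparr>pverts = {0, 1}, parcs = {(0, 1), (1, 0)}\<rparr>"

lemma complete_digraph_K2: "K\<^bsub>2\<^esub> (with_proj K2)"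
  by (auto simp: complete_digraph_pair_def K2_def)

end

theory Submission
  imports Defs "HOL-Library.Transitive_Closure_Table"
begin

text \<open>
  Work in one component, single out an arbitrary vertex \<open>r\<close>, and take a maximum cut \<open>(A, V - A)\<close> of
  the remaining vertices \<open>V\<close>. Start from weights in \<open>{2, 3}\<close> on the edges inside \<open>V\<close>, with the edges
  of weight 3 chosen so that the weighted degree of \<open>v \<in> V\<close> is odd iff \<open>v \<in> A\<close>. The edges at \<open>r\<close> keep
  the parity prescribed this way but may be low (1 or 2) or high (3 or 4), and a counting argument
  makes the degree of \<open>r\<close> differ from those of all its neighbours.

  Conflicts can now only occur on edges not crossing the cut. Process \<open>V\<close> greedily: an edge from a
  vertex \<open>v\<close> back to an earlier vertex \<open>u\<close> is allowed to contribute \<open>2\<epsilon>\<close>, with \<open>\<epsilon> \<in> {-1, 0, 1}\<close>, to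
  the degree of \<open>v\<close> and nothing to that of \<open>u\<close>. So \<open>d\<close> back edges offer \<open>2d + 1\<close> values, while at
  most \<open>d + 1\<close> are forbidden (by earlier neighbours and by \<open>r\<close>). This asymmetric change is the
  weight change \<open>\<epsilon>\<close> of the edge plus a transfer of one unit of degree between its endpoints, and all
  transfers together are carried out by a flow along the cut edges with values in \<open>{-1, 0, 1}\<close>: Gale's
  condition for the existence of this flow is exactly the maximality of the cut. All parities are
  preserved, and all weights stay in \<open>{1, 2, 3, 4}\<close>.
\<close>

section \<open>Greedy choice of degree shifts\<close>

lemma sum_of_signs:
  fixes j :: int
  assumes "finite B" "\<bar>j\<bar> \<le> int (card B)"
  shows "\<exists>f :: 'a \<Rightarrow> int. (\<forall>x. f x \<in> {-1, 0, 1}) \<and> (\<forall>x. x \<notin> B \<longrightarrow> f x = 0) \<and> sum f B = j"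
proof -
  obtain T where T: "T \<subseteq> B" "card T = nat \<bar>j\<bar>"
    using assms by (metis obtain_subset_with_card_n nat_le_iff)
  show ?thesis
  proof (intro exI[of _ "\<lambda>x. if x \<in> T then sgn j else 0"] conjI allI impI)
    show "(if x \<in> T then sgn j else 0) \<in> {-1, 0, 1}" for x by (auto simp: sgn_if)
    show "(if x \<in> T then sgn j else 0) = 0" if "x \<notin> B" for x using that T by auto
    have "(\<Sum>x\<in>B. if x \<in> T then sgn j else 0) = (\<Sum>x\<in>T. sgn j)"
      using T assms(1) by (intro sum.mono_neutral_cong_right) auto
    also have "\<dots> = j" using T by (cases j "0::int" rule: linorder_cases) auto
    finally show "(\<Sum>x\<in>B. if x \<in> T then sgn j else 0) = j" .
  qed
qed

text \<open>The \<open>2 * d + 1\<close> candidates are distinct and outnumber the forbidden values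
  once \<open>d > 0\<close>; for \<open>d = 0\<close> only \<open>j = 0\<close> is available, hence
  the third assumption.\<close>

lemma avoiding_shift:
  fixes c :: int
  assumes "finite Bl" "card Bl \<le> d + 1" "d = 0 \<Longrightarrow> c \<notin> Bl"
  obtains j where "\<bar>j\<bar> \<le> int d" "c + 2 * j \<notin> Bl"
proof (cases "d = 0")
  case True
  then show ?thesis using assms(3) that[of 0] by simp
next
  case False
  let ?S = "(\<lambda>j. c + 2 * j) ` {- int d..int d}"
  have "card ?S = 2 * d + 1" by (subst card_image) (auto simp: inj_on_def)
  then have "\<not> ?S \<subseteq> Bl" using card_mono[OF assms(1), of ?S] assms(2) False by linarith
  then have "\<exists>j\<in>{- int d..int d}. c + 2 * j \<notin> Bl" by blast
  then obtain j where "j \<in> {- int d..int d}" "c + 2 * j \<notin> Bl" by blast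
  then show ?thesis using that[of j] by auto
qed

text \<open>
  The value \<open>s v u\<close> is half of the contribution of the edge \<open>{u, v}\<close> to the shift at \<open>v\<close>; it can be
  nonzero only for the endpoint processed later.
\<close>
lemma greedy_shifts:
  fixes c :: "'a \<Rightarrow> int" and N :: "'a \<Rightarrow> 'a \<Rightarrow> bool"
  assumes "finite P" "symp N" "irreflp N" "\<forall>v\<in>D. c v \<noteq> \<sigma>"
  shows "\<exists>s :: 'a \<Rightarrow> 'a \<Rightarrow> int. (\<forall>u v. s u v \<in> {-1, 0, 1}) \<and> (\<forall>u v. s u v = 0 \<or> s v u = 0)
    \<and> (\<forall>u v. s u v \<noteq> 0 \<longrightarrow> u \<in> P \<and> v \<in> P \<and> N u v)
    \<and> (\<forall>u\<in>P. \<forall>v\<in>P. N u v \<longrightarrow> c u + 2 * (\<Sum>x\<in>P. s u x) \<noteq> c v + 2 * (\<Sum>x\<in>P. s v x))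
    \<and> (\<forall>v\<in>P \<inter> D. c v + 2 * (\<Sum>x\<in>P. s v x) \<noteq> \<sigma>)"
  using assms(1)
proof (induction P)
  case empty
  show ?case by (intro exI[of _ "\<lambda>_ _. 0"]) auto
next
  case (insert v P)
  then obtain s :: "'a \<Rightarrow> 'a \<Rightarrow> int" where "\<forall>u v. s u v \<in> {-1, 0, 1}" "\<forall>u v. s u v = 0 \<or> s v u = 0"
    "\<forall>u v. s u v \<noteq> 0 \<longrightarrow> u \<in> P \<and> v \<in> P \<and> N u v"
    "\<forall>u\<in>P. \<forall>v\<in>P. N u v \<longrightarrow> c u + 2 * (\<Sum>x\<in>P. s u x) \<noteq> c v + 2 * (\<Sum>x\<in>P. s v x)"
    "\<forall>v\<in>P \<inter> D. c v + 2 * (\<Sum>x\<in>P. s v x) \<noteq> \<sigma>"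
    by (elim exE conjE) (rule that)
  note s = this[rule_format]
  define F where "F u = c u + 2 * (\<Sum>x\<in>P. s u x)" for u
  define Q where "Q = {u \<in> P. N v u}"
  \<comment> \<open>Forbidden for \<open>v\<close>: the settled values of its earlier neighbours,
    and \<open>\<sigma>\<close>, which will be the degree of the singled-out vertex.\<close>
  define Bl where "Bl = F ` Q \<union> (if v \<in> D then {\<sigma>} else {})"
  have Q: "finite Q" "Q \<subseteq> P" using insert.hyps by (auto simp: Q_def)
  have "card Bl \<le> card (F ` Q) + card (if v \<in> D then {\<sigma>} else {})"
    unfolding Bl_def by (rule card_Un_le)
  also have "\<dots> \<le> card Q + 1" using card_image_le[OF Q(1), of F] by auto
  finally have card_Bl: "card Bl \<le> card Q + 1" .
  have fin_Bl: "finite Bl" using Q by (auto simp: Bl_def)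
  have "c v \<notin> Bl" if "card Q = 0" using that Q assms(4) by (auto simp: Bl_def)
  with fin_Bl card_Bl obtain j where j: "\<bar>j\<bar> \<le> int (card Q)" "c v + 2 * j \<notin> Bl"
    by (rule avoiding_shift)
  obtain f :: "'a \<Rightarrow> int" where "\<forall>x. f x \<in> {-1, 0, 1}"
    "\<forall>x. x \<notin> Q \<longrightarrow> f x = 0" "sum f Q = j"
    using sum_of_signs[OF Q(1) j(1)] by blast
  note f = this[rule_format]
  \<comment> \<open>The back edges are credited to \<open>v\<close> alone, so the values settled on
    \<open>P\<close> do not move.\<close>
  define s' where "s' u x = (if u = v then f x else s u x)" for u x
  have v: "v \<notin> P" "finite P" by fact+
  have s0: "s u x = 0" if "u = v \<or> x = v" for u x using s(3)[of u x] v that by auto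
  have fv: "f v = 0" using f(2)[of v] Q v by auto
  have "(\<Sum>x\<in>P. f x) = j"
    using f(2,3) Q v by (metis (mono_tags, lifting) sum.mono_neutral_right DiffE)
  then have Fv: "c v + 2 * (\<Sum>x\<in>insert v P. s' v x) = c v + 2 * j"
    using v fv by (simp add: s'_def)
  have Fu: "c u + 2 * (\<Sum>x\<in>insert v P. s' u x) = F u" if "u \<noteq> v" for u
    using that v s0 by (simp add: s'_def F_def)
  have nb: "F u \<noteq> c v + 2 * j" if "u \<in> P" "N u v" for u
    using that j(2) assms(2) by (auto simp: Bl_def Q_def image_iff dest: sympD)
  show ?case
  proof (intro exI[of _ s'] conjI allI ballI impI)
    show "s' u x \<in> {-1, 0, 1}" for u x using s(1) f(1) by (auto simp: s'_def)
    show "s' u x = 0 \<or> s' x u = 0" for u x using s(2) s0 fv by (auto simp: s'_def)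
    show "u \<in> insert v P" "x \<in> insert v P" "N u x" if "s' u x \<noteq> 0" for u x
      using that s(3)[of u x] f(2)[of x] Q by (auto simp: s'_def Q_def split: if_splits)
    show "c u + 2 * (\<Sum>x\<in>insert v P. s' u x) \<noteq> c y + 2 * (\<Sum>x\<in>insert v P. s' y x)"
      if uy: "u \<in> insert v P" "y \<in> insert v P" "N u y" for u y
    proof -
      consider "u = v" "y = v" | "u = v" "y \<in> P" "y \<noteq> v" | "u \<in> P" "u \<noteq> v" "y = v"
        | "u \<in> P" "u \<noteq> v" "y \<in> P" "y \<noteq> v" using uy v by blast
      then show ?thesis
      proof cases
        case 1 then show ?thesis using uy assms(3) by (auto dest: irreflpD)
      next
        case 2
        then show ?thesis using nb[of y] Fu[of y] Fv uy assms(2) by (auto dest: sympD)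
      next
        case 3
        then show ?thesis using nb[of u] Fu[of u] Fv uy by auto
      next
        case 4
        then show ?thesis using s(4)[of u y] Fu uy by (simp add: F_def)
      qed
    qed
    show "c u + 2 * (\<Sum>x\<in>insert v P. s' u x) \<noteq> \<sigma>" if "u \<in> insert v P \<inter> D" for u
    proof (cases "u = v")
      case True
      then show ?thesis using Fv j(2) that by (auto simp: Bl_def)
    next
      case False
      then show ?thesis using Fu[of u] s(5)[of u] that by (auto simp: F_def)
    qed
  qed
qed

section \<open>Flows with unit capacities\<close>

text \<open>Pairs inside \<open>X\<close> cancel, so only what leaves \<open>X\<close> counts; for
  \<open>X = V\<close> the whole sum vanishes.\<close>

lemma sum_antisym_cancel:
  fixes f :: "'a \<Rightarrow> 'a \<Rightarrow> int"
  assumes "finite V" "X \<subseteq> V" "\<And>u v. f u v = - f v u"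
  shows "(\<Sum>u\<in>X. \<Sum>v\<in>V. f u v) = (\<Sum>u\<in>X. \<Sum>v\<in>V - X. f u v)"
proof -
  have "(\<Sum>u\<in>X. \<Sum>v\<in>X. f u v) = (\<Sum>u\<in>X. \<Sum>v\<in>X. - f v u)"
    by (intro sum.cong refl assms(3))
  also have "\<dots> = - (\<Sum>u\<in>X. \<Sum>v\<in>X. f v u)" by (simp add: sum_negf)
  also have "(\<Sum>u\<in>X. \<Sum>v\<in>X. f v u) = (\<Sum>u\<in>X. \<Sum>v\<in>X. f u v)" by (rule sum.swap)
  finally have "(\<Sum>u\<in>X. \<Sum>v\<in>X. f u v) = 0" by simp
  moreover have "(\<Sum>v\<in>V. f u v) = (\<Sum>v\<in>V - X. f u v) + (\<Sum>v\<in>X. f u v)" for u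
    by (rule sum.subset_diff[OF assms(2,1)])
  ultimately show ?thesis by (simp add: sum.distrib)
qed

text \<open>A negative value is flow in the opposite direction. Conservation is absent on purpose:
  the net outflow of each vertex is prescribed separately.\<close>

definition unit_flow :: "('a \<Rightarrow> 'a \<Rightarrow> bool) \<Rightarrow> ('a \<Rightarrow> 'a \<Rightarrow> int) \<Rightarrow> bool" where
  "unit_flow K g \<longleftrightarrow> (\<forall>u v. g u v = - g v u) \<and> (\<forall>u v. \<bar>g u v\<bar> \<le> 1) \<and> (\<forall>u v. g u v \<noteq> 0 \<longrightarrow> K u v)"

lemma unit_flowD:
  assumes "unit_flow K g"
  shows "g u v = - g v u" "\<bar>g u v\<bar> \<le> 1" "g u v \<noteq> 0 \<Longrightarrow> K u v"
  using assms unfolding unit_flow_def by blast+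

lemma sum_of_bool_arc:
  assumes "finite C" "x \<in> C" "y \<in> C"
  shows "(\<Sum>u\<in>C. of_bool ((v, u) = (x, y))) = (of_bool (v = x) :: int)"
    and "(\<Sum>u\<in>C. of_bool ((u, v) = (x, y))) = (of_bool (v = y) :: int)"
proof -
  have "(\<Sum>u\<in>C. of_bool ((v, u) = (x, y))) = (\<Sum>u\<in>C. if u = y then of_bool (v = x) else (0 :: int))"
    by (intro sum.cong) auto
  then show "(\<Sum>u\<in>C. of_bool ((v, u) = (x, y))) = (of_bool (v = x) :: int)" using assms by simp
  have "(\<Sum>u\<in>C. of_bool ((u, v) = (x, y))) = (\<Sum>u\<in>C. if u = x then of_bool (v = y) else (0 :: int))"
    by (intro sum.cong) auto
  then show "(\<Sum>u\<in>C. of_bool ((u, v) = (x, y))) = (of_bool (v = y) :: int)" using assms by simp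
qed

text \<open>One unit is sent along the path, arc by arc. Residual capacity is demanded only among
  the vertices of the path: pushing through the first arc alters only arcs at the first vertex,
  which the rest of a distinct path avoids, so the induction goes through.\<close>

lemma unit_flow_push:
  fixes g :: "'a \<Rightarrow> 'a \<Rightarrow> int"
  assumes "finite V" "symp K" and KV: "\<And>u v. K u v \<Longrightarrow> u \<in> V \<and> v \<in> V"
    and "rtrancl_path R a xs b" "distinct (a # xs)" "unit_flow K g"
    and "\<And>u v. u \<in> set (a # xs) \<Longrightarrow> v \<in> set (a # xs) \<Longrightarrow> R u v \<Longrightarrow> K u v \<and> g u v < 1"
  shows "\<exists>g'. unit_flow K g' \<and>
    (\<forall>v. (\<Sum>u\<in>V. g' v u) = (\<Sum>u\<in>V. g v u) + of_bool (v = a) - of_bool (v = b))"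
  using assms(4-7)
proof (induction arbitrary: g)
  case (base x)
  then show ?case by auto
next
  case (step x y ys z)
  define g1 where "g1 u v = g u v + of_bool ((u, v) = (x, y)) - of_bool ((v, u) = (x, y))" for u v
  have xy: "K x y" "g x y < 1" using step.prems(3)[of x y] step.hyps(1) by auto
  have V: "x \<in> V" "y \<in> V" using KV[OF xy(1)] by auto
  have yx: "K y x" using sympD[OF assms(2) xy(1)] .
  have neq: "x \<noteq> y" using step.prems(1) by auto
  note V = V yx neq
  note flow = unit_flowD[OF step.prems(2)]
  have anti: "g u v + g v u = 0" for u v using flow(1)[of u v] by linarith
  have flow_g1: "unit_flow K g1"
    unfolding unit_flow_def
  proof (intro conjI allI impI)
    show "g1 u v = - g1 v u" for u v unfolding g1_def using flow(1)[of u v] by linarith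
    show "\<bar>g1 u v\<bar> \<le> 1" for u v
      using flow(2)[of u v] anti[of y x] xy(2) neq by (auto simp: g1_def of_bool_def split: if_splits)
    show "K u v" if "g1 u v \<noteq> 0" for u v
      using that flow(3)[of u v] xy(1) yx by (auto simp: g1_def of_bool_def split: if_splits)
  qed
  have residual: "K u v \<and> g1 u v < 1" if "u \<in> set (y # ys)" "v \<in> set (y # ys)" "R u v" for u v
  proof -
    have "u \<noteq> x" "v \<noteq> x" using that step.prems(1) by auto
    then show ?thesis using step.prems(3)[of u v] that by (simp add: g1_def)
  qed
  have "distinct (y # ys)" using step.prems(1) by simp
  from step.IH[OF this flow_g1 residual] obtain g' where g': "unit_flow K g'"
    "\<And>v. (\<Sum>u\<in>V. g' v u) = (\<Sum>u\<in>V. g1 v u) + of_bool (v = y) - of_bool (v = z)"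
    by blast
  have g1: "(\<Sum>u\<in>V. g1 v u) = (\<Sum>u\<in>V. g v u) + of_bool (v = x) - of_bool (v = y)" for v
    unfolding g1_def sum.distrib sum_subtractf sum_of_bool_arc[OF assms(1) V(1,2)] ..
  show ?case using g' g1 by auto
qed

text \<open>Augmenting a flow of least total imbalance along a residual path would contradict its choice.\<close>
lemma unit_flow_with_supply:
  fixes b :: "'a \<Rightarrow> int"
  assumes "finite V" "symp K" and KV: "\<And>u v. K u v \<Longrightarrow> u \<in> V \<and> v \<in> V"
    and total: "sum b V = 0"
    and cut: "\<And>X. X \<subseteq> V \<Longrightarrow> sum b X \<le> (\<Sum>u\<in>X. \<Sum>v\<in>V - X. of_bool (K u v))"
  shows "\<exists>g. unit_flow K g \<and> (\<forall>v\<in>V. (\<Sum>u\<in>V. g v u) = b v)"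
proof -
  define ex where "ex g v = b v - (\<Sum>u\<in>V. g v u)" for g v
  define m where "m g = nat (\<Sum>v\<in>V. \<bar>ex g v\<bar>)" for g
  have "unit_flow K (\<lambda>_ _. 0)" by (simp add: unit_flow_def)
  then obtain g where g: "unit_flow K g" "\<And>g'. unit_flow K g' \<Longrightarrow> m g \<le> m g'"
    using ex_has_least_nat[of "unit_flow K" _ m] by blast
  note flow = unit_flowD[OF g(1)]
  have total_ex: "(\<Sum>v\<in>V. ex g v) = 0"
    using sum_antisym_cancel[OF assms(1) order_refl flow(1)] total
    by (simp add: ex_def sum_subtractf)
  have no_pos: "ex g a \<le> 0" if a: "a \<in> V" for a
  proof (rule ccontr)
    assume pos: "\<not> ex g a \<le> 0"
    define R where "R u v \<longleftrightarrow> K u v \<and> g u v < 1" for u v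
    \<comment> \<open>\<open>X\<close> has no deficient vertex, since augmenting towards one would
      lower \<open>m\<close>, and all \<open>K\<close>-arcs leaving it are saturated. By the cut
      condition its total excess is then at most 0, although \<open>a\<close> contributes a positive
      amount.\<close>
    define X where "X = {v. R\<^sup>*\<^sup>* a v}"
    have "v \<in> V" if "R\<^sup>*\<^sup>* a v" for v
      using that by (induction) (auto simp: a R_def KV)
    then have X: "X \<subseteq> V" "a \<in> X" by (auto simp: X_def)
    have nonneg: "ex g y \<ge> 0" if y: "y \<in> X" for y
    proof (rule ccontr)
      assume neg: "\<not> ex g y \<ge> 0"
      from y obtain xs where "rtrancl_path R a xs y"
        by (auto simp: X_def rtranclp_eq_rtrancl_path)
      then obtain xs where xs: "rtrancl_path R a xs y" "distinct (a # xs)"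
        using rtrancl_path_distinct by metis
      obtain g' where g': "unit_flow K g'"
        "\<And>v. (\<Sum>u\<in>V. g' v u) = (\<Sum>u\<in>V. g v u) + of_bool (v = a) - of_bool (v = y)"
        using unit_flow_push[OF assms(1-3) xs g(1)] by (auto simp: R_def)
      have "(\<Sum>v\<in>V. \<bar>ex g' v\<bar>) < (\<Sum>v\<in>V. \<bar>ex g v\<bar>)"
      proof (rule sum_strict_mono_ex1)
        show "finite V" by fact
        show "\<forall>v\<in>V. \<bar>ex g' v\<bar> \<le> \<bar>ex g v\<bar>" using pos neg by (auto simp: ex_def g'(2))
        show "\<exists>v\<in>V. \<bar>ex g' v\<bar> < \<bar>ex g v\<bar>"
          using pos neg by (intro bexI[OF _ a]) (auto simp: ex_def g'(2))
      qed
      moreover have "0 \<le> (\<Sum>v\<in>V. \<bar>ex g' v\<bar>)" by (simp add: sum_nonneg)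
      ultimately have "m g' < m g" unfolding m_def by linarith
      then show False using g(2)[OF g'(1)] by simp
    qed
    have out: "g u v = of_bool (K u v)" if "u \<in> X" "v \<in> V - X" for u v
    proof (cases "K u v")
      case True
      then have "\<not> g u v < 1" using that by (auto simp: X_def R_def dest: rtranclp.rtrancl_into_rtrancl)
      then show ?thesis using True flow(2)[of u v] by simp
    next
      case False
      then show ?thesis using flow(3)[of u v] by auto
    qed
    have "(\<Sum>v\<in>X. ex g v) = sum b X - (\<Sum>u\<in>X. \<Sum>v\<in>V - X. g u v)"
      using sum_antisym_cancel[OF assms(1) X(1) flow(1)] by (simp add: ex_def sum_subtractf)
    also have "\<dots> = sum b X - (\<Sum>u\<in>X. \<Sum>v\<in>V - X. of_bool (K u v))"
      using out by simp
    also have "\<dots> \<le> 0" using cut[OF X(1)] by simp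
    finally have "(\<Sum>v\<in>X. ex g v) \<le> 0" .
    moreover have "ex g a \<le> (\<Sum>v\<in>X. ex g v)"
      using X nonneg assms(1) by (intro member_le_sum) (auto intro: finite_subset)
    ultimately show False using pos by simp
  qed
  have "ex g v = 0" if "v \<in> V" for v
  proof -
    have "(\<Sum>v\<in>V. - ex g v) = 0" using total_ex by (simp add: sum_negf)
    then have "\<forall>v\<in>V. - ex g v = 0" using no_pos assms(1) by (subst (asm) sum_nonneg_eq_0_iff) auto
    then show ?thesis using that by auto
  qed
  with g(1) show ?thesis by (auto simp: ex_def)
qed

section \<open>Maximum cuts\<close>

text \<open>\<open>A\<close> minimises the number of uncut edges. Moving all of \<open>X\<close> to
  the other side swaps cut and uncut edges between \<open>X\<close> and \<open>V - X\<close> and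
  leaves all others as they were, so it cannot bring a gain.\<close>

lemma max_cut:
  fixes adj :: "'a \<Rightarrow> 'a \<Rightarrow> bool"
  assumes "finite V" "symp adj"
  obtains A where "\<And>X. X \<subseteq> V \<Longrightarrow>
    (\<Sum>u\<in>X. \<Sum>v\<in>V - X. of_bool (adj u v \<and> (u \<in> A \<longleftrightarrow> v \<in> A))) \<le>
    (\<Sum>u\<in>X. \<Sum>v\<in>V - X. (of_bool (adj u v \<and> (u \<in> A \<longleftrightarrow> v \<notin> A)) :: int))"
proof -
  define e :: "'a set \<Rightarrow> 'a \<Rightarrow> 'a \<Rightarrow> int"
    where "e A u v = of_bool (adj u v \<and> (u \<in> A \<longleftrightarrow> v \<in> A))" for A u v
  define m where "m A = nat (\<Sum>u\<in>V. \<Sum>v\<in>V. e A u v)" for A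
  have m: "int (m A) = (\<Sum>u\<in>V. \<Sum>v\<in>V. e A u v)" for A
    by (simp add: m_def e_def sum_nonneg)
  obtain A where A: "\<And>B. m A \<le> m B"
    using ex_has_least_nat[of "\<lambda>_. True" _ m] by auto
  show ?thesis
  proof (rule that[of A])
    fix X assume X: "X \<subseteq> V"
    \<comment> \<open>The symmetric difference: exactly the vertices of \<open>X\<close> change
      sides.\<close>
    define B where "B = (A - X) \<union> (X - A)"
    have split: "(\<Sum>u\<in>V. \<Sum>v\<in>V. f u v) = (\<Sum>u\<in>X. \<Sum>v\<in>X. f u v)
        + (\<Sum>u\<in>V - X. \<Sum>v\<in>V - X. f u v) + 2 * (\<Sum>u\<in>X. \<Sum>v\<in>V - X. f u v)"
      if f: "\<And>u v. f u v = f v u" for f :: "'a \<Rightarrow> 'a \<Rightarrow> int"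
    proof -
      have "(\<Sum>u\<in>V - X. \<Sum>v\<in>X. f u v) = (\<Sum>v\<in>X. \<Sum>u\<in>V - X. f u v)" by (rule sum.swap)
      also have "\<dots> = (\<Sum>u\<in>X. \<Sum>v\<in>V - X. f u v)" by (intro sum.cong refl f)
      finally show ?thesis
        using X assms(1) by (simp add: sum.subset_diff[of X V] sum.distrib)
    qed
    have e_sym: "e A u v = e A v u" for A u v
      using assms(2) by (auto simp: e_def dest: sympD)
    have "(\<Sum>u\<in>V. \<Sum>v\<in>V. e A u v) \<le> (\<Sum>u\<in>V. \<Sum>v\<in>V. e B u v)"
      using A[of B] m by (metis of_nat_mono)
    moreover have "(\<Sum>u\<in>X. \<Sum>v\<in>X. e B u v) = (\<Sum>u\<in>X. \<Sum>v\<in>X. e A u v)"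
      by (intro sum.cong refl) (auto simp: e_def B_def)
    moreover have "(\<Sum>u\<in>V - X. \<Sum>v\<in>V - X. e B u v) = (\<Sum>u\<in>V - X. \<Sum>v\<in>V - X. e A u v)"
      by (intro sum.cong refl) (auto simp: e_def B_def)
    ultimately have "(\<Sum>u\<in>X. \<Sum>v\<in>V - X. e A u v) \<le> (\<Sum>u\<in>X. \<Sum>v\<in>V - X. e B u v)"
      using split[where f = "e A", OF e_sym] split[where f = "e B", OF e_sym] by linarith
    also have "\<dots> = (\<Sum>u\<in>X. \<Sum>v\<in>V - X. of_bool (adj u v \<and> (u \<in> A \<longleftrightarrow> v \<notin> A)))"
      by (intro sum.cong refl) (auto simp: e_def B_def)
    finally show "(\<Sum>u\<in>X. \<Sum>v\<in>V - X. of_bool (adj u v \<and> (u \<in> A \<longleftrightarrow> v \<in> A))) \<le>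
      (\<Sum>u\<in>X. \<Sum>v\<in>V - X. (of_bool (adj u v \<and> (u \<in> A \<longleftrightarrow> v \<notin> A)) :: int))"
      by (simp add: e_def)
  qed
qed

section \<open>Edge sets with prescribed degree parities\<close>

text \<open>Adding 1 to each edge traversed by a walk changes parities only at its two ends. Edges
  may be reused, so \<open>h\<close> is not bounded; with two indicators the case
  \<open>a = b\<close> is covered too.\<close>

lemma path_parity:
  fixes adj :: "'a \<Rightarrow> 'a \<Rightarrow> bool"
  assumes "finite C" "symp adj" "\<And>u v. adj u v \<Longrightarrow> u \<in> C \<and> v \<in> C" "adj\<^sup>*\<^sup>* a b"
  shows "\<exists>h :: 'a \<Rightarrow> 'a \<Rightarrow> int. (\<forall>u v. h u v = h v u) \<and> (\<forall>u v. h u v \<noteq> 0 \<longrightarrow> adj u v) \<and>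
    (\<forall>v. even ((\<Sum>u\<in>C. h v u) + of_bool (v = a) + of_bool (v = b)))"
  using assms(4)
proof (induction rule: converse_rtranclp_induct)
  case base
  show ?case by (intro exI[of _ "\<lambda>_ _. 0"]) auto
next
  case (step x y)
  then obtain h :: "'a \<Rightarrow> 'a \<Rightarrow> int" where h: "\<And>u v. h u v = h v u" "\<And>u v. h u v \<noteq> 0 \<Longrightarrow> adj u v"
    "\<And>v. even ((\<Sum>u\<in>C. h v u) + of_bool (v = y) + of_bool (v = b))" by blast
  define h1 where "h1 u v = h u v + of_bool ((u, v) = (x, y)) + of_bool ((v, u) = (x, y))" for u v
  have C: "x \<in> C" "y \<in> C" "adj y x"
    using assms(3)[OF step.hyps(1)] sympD[OF assms(2) step.hyps(1)] by auto
  have sum: "(\<Sum>u\<in>C. h1 v u) = (\<Sum>u\<in>C. h v u) + of_bool (v = x) + of_bool (v = y)" for v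
    unfolding h1_def sum.distrib sum_of_bool_arc[OF assms(1) C(1,2)] ..
  show ?case
  proof (intro exI[of _ h1] conjI allI impI)
    show "h1 u v = h1 v u" for u v unfolding h1_def using h(1)[of u v] by linarith
    show "adj u v" if "h1 u v \<noteq> 0" for u v
      using that h(2)[of u v] step.hyps(1) C(3) by (auto simp: h1_def of_bool_def split: if_splits)
    show "even ((\<Sum>u\<in>C. h1 v u) + of_bool (v = x) + of_bool (v = b))" for v
      using h(3)[of v] unfolding sum by auto
  qed
qed

text \<open>A T-join: walks from the vertices of \<open>A\<close> to \<open>r\<close> are superposed
  modulo 2. Away from \<open>r\<close> each is odd only at its start, and any remaining defect of
  parity is pushed to \<open>r\<close>, where nothing is claimed.\<close>

lemma parity_subgraph:
  fixes adj :: "'a \<Rightarrow> 'a \<Rightarrow> bool"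
  assumes "finite C" "symp adj" "\<And>u v. adj u v \<Longrightarrow> u \<in> C \<and> v \<in> C"
    and "\<And>v. v \<in> C \<Longrightarrow> adj\<^sup>*\<^sup>* v r"
  obtains h :: "'a \<Rightarrow> 'a \<Rightarrow> int"
  where "\<And>u v. h u v = h v u" "\<And>u v. h u v \<in> {0, 1}" "\<And>u v. h u v \<noteq> 0 \<Longrightarrow> adj u v"
    "\<And>v. v \<in> C - {r} \<Longrightarrow> odd (\<Sum>u\<in>C. h v u) \<longleftrightarrow> v \<in> A"
proof -
  have "\<forall>a\<in>C. \<exists>h :: 'a \<Rightarrow> 'a \<Rightarrow> int. (\<forall>u v. h u v = h v u) \<and> (\<forall>u v. h u v \<noteq> 0 \<longrightarrow> adj u v) \<and>
    (\<forall>v. even ((\<Sum>u\<in>C. h v u) + of_bool (v = a) + of_bool (v = r)))"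
    using path_parity[OF assms(1-3)] assms(4) by blast
  then obtain h :: "'a \<Rightarrow> 'a \<Rightarrow> 'a \<Rightarrow> int" where h: "\<And>a u v. a \<in> C \<Longrightarrow> h a u v = h a v u"
    "\<And>a u v. a \<in> C \<Longrightarrow> h a u v \<noteq> 0 \<Longrightarrow> adj u v"
    "\<And>a v. a \<in> C \<Longrightarrow> even ((\<Sum>u\<in>C. h a v u) + of_bool (v = a) + of_bool (v = r))"
    by metis
  define H where "H u v = (\<Sum>a\<in>C \<inter> A. h a u v) mod 2" for u v
  show ?thesis
  proof (rule that[of H])
    show "H u v = H v u" for u v unfolding H_def using h(1) by (metis (no_types, lifting) IntD1 sum.cong)
    show "H u v \<in> {0, 1}" for u v by (auto simp: H_def)
    show "adj u v" if "H u v \<noteq> 0" for u v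
    proof (rule ccontr)
      assume "\<not> adj u v"
      then have "(\<Sum>a\<in>C \<inter> A. h a u v) = 0" using h(2) by (intro sum.neutral) auto
      then show False using that by (simp add: H_def)
    qed
    show "odd (\<Sum>u\<in>C. H v u) \<longleftrightarrow> v \<in> A" if v: "v \<in> C - {r}" for v
    proof -
      have "(\<Sum>u\<in>C. H v u) mod 2 = (\<Sum>u\<in>C. \<Sum>a\<in>C \<inter> A. h a v u) mod 2"
        unfolding H_def by (rule mod_sum_eq)
      also have "(\<Sum>u\<in>C. \<Sum>a\<in>C \<inter> A. h a v u) = (\<Sum>a\<in>C \<inter> A. \<Sum>u\<in>C. h a v u)" by (rule sum.swap)
      also have "\<dots> mod 2 = (\<Sum>a\<in>C \<inter> A. (\<Sum>u\<in>C. h a v u) mod 2) mod 2" by (rule mod_sum_eq[symmetric])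
      also have "(\<Sum>a\<in>C \<inter> A. (\<Sum>u\<in>C. h a v u) mod 2) = (\<Sum>a\<in>C \<inter> A. of_bool (a = v))"
      proof (intro sum.cong refl)
        fix a assume "a \<in> C \<inter> A"
        then show "(\<Sum>u\<in>C. h a v u) mod 2 = of_bool (a = v)"
          using h(3)[of a v] v by (cases "a = v") (auto, presburger)
      qed
      also have "\<dots> = of_bool (v \<in> A)"
        using v assms(1) by (simp add: of_bool_def)
      finally show ?thesis by (cases "v \<in> A") (simp_all add: odd_iff_mod_2_eq_one even_iff_mod_2_eq_zero)
    qed
  qed
qed

section \<open>Separating the singled-out vertex from its neighbours\<close>

text \<open>
  With \<open>n\<^sub>k = card (S k)\<close>, a suitable set of size \<open>k\<close> exists as soon as \<open>n\<^sub>k \<le> k\<close> and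
  \<open>k + n\<^sub>k\<^sub>-\<^sub>1 \<le> card D\<close>; the least \<open>k\<close> with \<open>n\<^sub>k \<le> k\<close> works except in degenerate cases, where
  \<open>k + 1\<close> does.
\<close>
lemma raised_subset:
  fixes a :: "'a \<Rightarrow> int"
  assumes "finite D" and single: "card D = 1 \<Longrightarrow> \<forall>s\<in>D. a s \<noteq> L"
  obtains X where "X \<subseteq> D" "\<And>s. s \<in> D \<Longrightarrow> a s + 2 * of_bool (s \<in> X) \<noteq> L + 2 * int (card X)"
proof -
  note pick = that
  \<comment> \<open>If \<open>card X = k\<close>, an unraised \<open>s\<close> clashes exactly when
    it lies in \<open>S k\<close>, a raised one exactly when it lies in \<open>S (k - 1)\<close>. So
    \<open>X\<close> has to contain the former and avoid the latter.\<close>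
  define S where "S k = {s \<in> D. a s = L + 2 * k}" for k :: int
  have fS: "finite (S k)" "S k \<subseteq> D" for k using assms(1) by (auto simp: S_def)
  have disj: "S i \<inter> S j = {}" if "i \<noteq> j" for i j using that by (auto simp: S_def)
  have two: "card (S i) + card (S j) \<le> card D" if "i \<noteq> j" for i j
  proof -
    have "card (S i) + card (S j) = card (S i \<union> S j)"
      using disj that fS by (simp add: card_Un_disjoint)
    also have "\<dots> \<le> card D" using fS assms(1) by (intro card_mono) auto
    finally show ?thesis .
  qed
  have three: "card (S i) + card (S j) + card (S l) \<le> card D" if "i \<noteq> j" "j \<noteq> l" "i \<noteq> l" for i j l
  proof -
    have "(S i \<union> S j) \<inter> S l = {}" using disj[of i l] disj[of j l] that by auto
    then have "card (S i) + card (S j) + card (S l) = card (S i \<union> S j \<union> S l)"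
      using disj that fS by (simp add: card_Un_disjoint)
    also have "\<dots> \<le> card D" using fS assms(1) by (intro card_mono) auto
    finally show ?thesis .
  qed
  have step: thesis if k: "card (S (int k)) \<le> k" "k + card (S (int k - 1)) \<le> card D" for k
  proof -
    have "S (int k) \<subseteq> D - S (int k - 1)" using fS disj[of "int k" "int k - 1"] by auto
    moreover have "k \<le> card (D - S (int k - 1))" using k(2) fS assms(1) by (simp add: card_Diff_subset)
    ultimately obtain X where X: "S (int k) \<subseteq> X" "X \<subseteq> D - S (int k - 1)" "card X = k"
      using exists_subset_between[OF k(1)] finite_Diff[OF assms(1)] by meson
    show thesis
    proof (rule pick[of X])
      show "X \<subseteq> D" using X by blast
      show "a s + 2 * of_bool (s \<in> X) \<noteq> L + 2 * int (card X)" if "s \<in> D" for s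
      proof (cases "s \<in> X")
        case True
        then have "s \<notin> S (int k - 1)" using X by blast
        then show ?thesis using True that X(3) by (simp add: S_def)
      next
        case False
        then have "s \<notin> S (int k)" using X by blast
        then show ?thesis using False that X(3) by (simp add: S_def)
      qed
    qed
  qed
  define k where "k = (LEAST k. card (S (int k)) \<le> k)"
  have k: "card (S (int k)) \<le> k"
    unfolding k_def by (rule LeastI[of _ "card D"]) (use fS assms(1) in \<open>auto intro: card_mono\<close>)
  have less: "j < card (S (int j))" if "j < k" for j
    using not_less_Least[of j "\<lambda>k. card (S (int k)) \<le> k"] that by (simp add: k_def not_le)
  consider "k = 0" | "k = 1" | "k = 2" | "k \<ge> 3" by linarith
  then show thesis
  proof cases
    case 1
    have "S (-1) \<subseteq> D" "card (S (-1)) \<le> card D" using fS assms(1) by (auto intro: card_mono)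
    then show thesis using step[of 0] k 1 by simp
  next
    case 2
    show thesis
    proof (cases "card (S 0) = card D")
      case True
      \<comment> \<open>All other classes are empty, so size 2 works unless \<open>D\<close> is a
        singleton, which \<open>single\<close> excludes.\<close>
      have "S 0 = D" using True fS assms(1) by (simp add: card_subset_eq)
      have "card D \<noteq> 1"
      proof
        assume one: "card D = 1"
        then obtain s where "s \<in> D" by (auto simp: card_1_singleton_iff)
        with \<open>S 0 = D\<close> have "a s = L" by (auto simp: S_def)
        then show False using single[OF one] \<open>s \<in> D\<close> by blast
      qed
      then show thesis using step[of 2] two[of 0 1] two[of 0 2] True less[of 0] 2 by simp
    next
      case False
      then have "card (S 0) < card D" using two[of 0 1] by linarith
      then show thesis using step[of 1] k 2 by simp
    qed
  next
    case 3
    show thesis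
    proof (cases "2 + card (S 1) \<le> card D")
      case True
      then show thesis using step[of 2] k 3 by simp
    next
      case False
      \<comment> \<open>Here \<open>S 0\<close> and \<open>S 1\<close> exhaust \<open>D\<close>,
        which has at least 3 elements, so \<open>S 2\<close> and \<open>S 3\<close> are
        empty.\<close>
      then show thesis
        using step[of 3] three[of 0 1 2] three[of 0 1 3] less[of 0] less[of 1] 3 by simp
    qed
  next
    case 4
    \<comment> \<open>As \<open>k \<ge> 3\<close>, the indices \<open>0\<close> and
      \<open>k - 2\<close> differ; by minimality of \<open>k\<close> their classes have at least
      \<open>1\<close> and \<open>k - 1\<close> elements, together \<open>k\<close>.\<close>
    have "card (S (int (k - 1))) + card (S (int (k - 2))) + card (S (int 0)) \<le> card D"
      using 4 by (intro three) auto
    then have "k + card (S (int (k - 1))) \<le> card D" using less[of 0] less[of "k - 2"] 4 by linarith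
    moreover have "int (k - 1) = int k - 1" using 4 by simp
    ultimately show thesis using step[of k] k by simp
  qed
qed

section \<open>The weighting of one component\<close>

lemma weighting_connected:
  fixes adj :: "'a \<Rightarrow> 'a \<Rightarrow> bool"
  assumes fin: "finite C" and sym: "symp adj" and irr: "irreflp adj"
    and adjC: "\<And>u v. adj u v \<Longrightarrow> u \<in> C \<and> v \<in> C"
    and r: "r \<in> C" and conn: "\<And>v. v \<in> C \<Longrightarrow> adj\<^sup>*\<^sup>* v r"
    and no_K2: "\<And>u v. adj u v \<Longrightarrow> \<exists>w. adj u w \<and> w \<noteq> v \<or> adj v w \<and> w \<noteq> u"
  shows "\<exists>W :: 'a \<Rightarrow> 'a \<Rightarrow> int. (\<forall>u v. W u v = W v u) \<and> (\<forall>u v. adj u v \<longrightarrow> W u v \<in> {1..4})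
    \<and> (\<forall>u v. \<not> adj u v \<longrightarrow> W u v = 0)
    \<and> (\<forall>u v. adj u v \<longrightarrow> (\<Sum>x\<in>C. W u x) \<noteq> (\<Sum>x\<in>C. W v x))"
proof -
  have adj_sym: "adj u v \<longleftrightarrow> adj v u" for u v using sym by (blast dest: sympD)
  have adj_neq: "u \<noteq> v" if "adj u v" for u v using irr that by (blast dest: irreflpD)
  define V where "V = C - {r}"
  have finV: "finite V" and V: "C = insert r V" "r \<notin> V" using fin r by (auto simp: V_def)
  obtain A where A: "\<And>X. X \<subseteq> V \<Longrightarrow>
    (\<Sum>u\<in>X. \<Sum>v\<in>V - X. of_bool (adj u v \<and> (u \<in> A \<longleftrightarrow> v \<in> A))) \<le>
    (\<Sum>u\<in>X. \<Sum>v\<in>V - X. (of_bool (adj u v \<and> (u \<in> A \<longleftrightarrow> v \<notin> A)) :: int))"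
    using max_cut[OF finV sym] by blast
  obtain h :: "'a \<Rightarrow> 'a \<Rightarrow> int" where h: "\<And>u v. h u v = h v u" "\<And>u v. h u v \<in> {0, 1}"
    "\<And>u v. h u v \<noteq> 0 \<Longrightarrow> adj u v" "\<And>v. v \<in> C - {r} \<Longrightarrow> odd (\<Sum>u\<in>C. h v u) \<longleftrightarrow> v \<in> A"
    using parity_subgraph[OF fin sym adjC conn, of A] by metis
  \<comment> \<open>Both \<open>2 - h u v\<close> and \<open>2 + h u v\<close> have the parity of
    \<open>h u v\<close>. Edges at \<open>r\<close> start low, leaving room to add 2; the others
    leave room for a change of 1 either way.\<close>
  define B0 where "B0 u v = (if adj u v then if u = r \<or> v = r then 2 - h u v else 2 + h u v else 0)" for u v
  define D where "D = {s. adj r s}"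
  have D: "D \<subseteq> V" "finite D" using adjC adj_neq finV by (auto simp: D_def V_def intro: finite_subset)
  define a where "a v = (\<Sum>u\<in>C. B0 v u)" for v
  have B0_sym: "B0 u v = B0 v u" for u v using h(1)[of u v] adj_sym[of u v] by (auto simp: B0_def)
  have B0_range: "B0 u v \<in> {1..3}" if "adj u v" for u v using that h(2)[of u v] by (auto simp: B0_def)
  have B0_nonneg: "0 \<le> B0 u v" for u v using B0_range[of u v] by (cases "adj u v") (auto simp: B0_def)
  \<comment> \<open>By \<open>no_K2\<close>, a sole neighbour \<open>s\<close> of \<open>r\<close>
    has a further edge, whose positive weight puts \<open>a s\<close> above
    \<open>a r\<close>.\<close>
  have leaf: "\<forall>s\<in>D. a s \<noteq> a r" if "card D = 1"
  proof
    fix s assume s: "s \<in> D"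
    with that have Ds: "D = {s}" by (auto simp: card_1_singleton_iff)
    then have rs: "adj r u \<longleftrightarrow> u = s" for u by (auto simp: D_def)
    obtain w where w: "adj s w" "w \<noteq> r" using no_K2[of r s] rs by auto
    have "a r = (\<Sum>u\<in>C. if u = s then B0 r s else 0)"
      unfolding a_def by (intro sum.cong) (auto simp: B0_def rs)
    also have "\<dots> = B0 s r" using D s V(1) fin B0_sym by auto
    also have "\<dots> < B0 s r + B0 s w" using B0_range[OF w(1)] by simp
    also have "\<dots> = (\<Sum>u\<in>{r, w}. B0 s u)" using w by simp
    also have "\<dots> \<le> a s" unfolding a_def
      using fin r adjC[OF w(1)] B0_nonneg by (intro sum_mono2) auto
    finally show "a s \<noteq> a r" by simp
  qed
  \<comment> \<open>The edges from \<open>r\<close> to \<open>X\<close> are raised from low to high,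
    each adding 2 to both of its ends.\<close>
  obtain X where X: "X \<subseteq> D" "\<And>s. s \<in> D \<Longrightarrow> a s + 2 * of_bool (s \<in> X) \<noteq> a r + 2 * int (card X)"
    using raised_subset[OF D(2) leaf] by metis
  define B where "B u v = B0 u v + 2 * of_bool (u = r \<and> v \<in> X \<or> v = r \<and> u \<in> X)" for u v
  define c where "c v = (\<Sum>u\<in>C. B v u)" for v
  have "r \<notin> X" using X(1) D V(2) by auto
  then have c: "c v = a v + 2 * of_bool (v \<in> X)" if "v \<in> V" for v
  proof -
    have "B v u = B0 v u + (if u = r then 2 * of_bool (v \<in> X) else 0)" for u
      using that V by (auto simp: B_def)
    then show ?thesis using fin r by (simp add: c_def a_def sum.distrib)
  qed
  have cr: "c r = a r + 2 * int (card X)"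
  proof -
    have "B r u = B0 r u + 2 * of_bool (u \<in> X)" for u using \<open>r \<notin> X\<close> by (auto simp: B_def)
    moreover have "(\<Sum>u\<in>C. of_bool (u \<in> X)) = (of_nat (card X) :: int)"
    proof -
      have "C \<inter> X = X" using X(1) D(1) V(1) by blast
      then show ?thesis using fin by simp
    qed
    ultimately show ?thesis by (simp add: c_def a_def sum.distrib flip: sum_distrib_left)
  qed
  have c_neq: "\<forall>s\<in>D. c s \<noteq> c r" using X(2) c cr D(1) by auto
  have B_sym: "B u v = B v u" for u v using B0_sym[of u v] by (auto simp: B_def)
  have c_parity: "odd (c v) \<longleftrightarrow> v \<in> A" if v: "v \<in> V" for v
  proof -
    have "even (B v u - h v u)" for u
      using h(3)[of v u] by (cases "h v u = 0") (auto simp: B_def B0_def)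
    then have "even (\<Sum>u\<in>C. B v u - h v u)" by (intro dvd_sum) auto
    then show ?thesis using h(4)[of v] v by (simp add: c_def sum_subtractf V_def)
  qed
  define N where "N u v \<longleftrightarrow> u \<in> V \<and> v \<in> V \<and> adj u v \<and> (u \<in> A \<longleftrightarrow> v \<in> A)" for u v
  define K where "K u v \<longleftrightarrow> u \<in> V \<and> v \<in> V \<and> adj u v \<and> (u \<in> A \<longleftrightarrow> v \<notin> A)" for u v
  have N_sym: "symp N" using adj_sym by (auto simp: N_def intro!: sympI)
  have K_sym: "symp K" using adj_sym by (auto simp: K_def intro!: sympI)
  have N_irr: "irreflp N" by (auto simp: N_def intro!: irreflpI dest: adj_neq)
  obtain s :: "'a \<Rightarrow> 'a \<Rightarrow> int" where "\<forall>u v. s u v \<in> {-1, 0, 1}" "\<forall>u v. s u v = 0 \<or> s v u = 0"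
    "\<forall>u v. s u v \<noteq> 0 \<longrightarrow> u \<in> V \<and> v \<in> V \<and> N u v"
    "\<forall>u\<in>V. \<forall>v\<in>V. N u v \<longrightarrow> c u + 2 * (\<Sum>x\<in>V. s u x) \<noteq> c v + 2 * (\<Sum>x\<in>V. s v x)"
    "\<forall>v\<in>V \<inter> D. c v + 2 * (\<Sum>x\<in>V. s v x) \<noteq> c r"
    using greedy_shifts[OF finV N_sym N_irr c_neq]
    by (elim exE conjE) (rule that)
  note s = this[rule_format]
  \<comment> \<open>Changing the weight of \<open>{u, v}\<close> by \<open>s u v + s v u\<close>
    acts on both ends alike, while \<open>v\<close> is to gain \<open>2 * s v u\<close>: it still
    lacks \<open>s v u - s u v\<close>. Changes on cut edges also act on both ends alike; flipping
    signs outside \<open>A\<close> turns them into an antisymmetric flow.\<close>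
  define \<delta> where "\<delta> v u = (s v u - s u v) * (if v \<in> A then 1 else -1)" for v u
  have \<delta>_anti: "\<delta> u v = - \<delta> v u" for u v
    using s(3)[of u v] s(3)[of v u]
    by (cases "s u v = 0"; cases "s v u = 0") (auto simp: \<delta>_def N_def)
  \<comment> \<open>The bound is 1 rather than 2 because \<open>s u v\<close> and
    \<open>s v u\<close> are never both nonzero.\<close>
  have \<delta>_le: "\<delta> u v \<le> of_bool (adj u v \<and> (u \<in> A \<longleftrightarrow> v \<in> A))" for u v
    using s(1)[of u v] s(1)[of v u] s(2)[of u v] s(3)[of u v] s(3)[of v u] adj_sym[of u v]
    by (auto simp: \<delta>_def N_def)
  have total: "(\<Sum>v\<in>V. \<Sum>u\<in>V. \<delta> v u) = 0"
    using sum_antisym_cancel[OF finV order_refl \<delta>_anti] by simp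
  \<comment> \<open>Gale's condition: the demand of \<open>Y\<close> is at most the number of uncut
    edges leaving \<open>Y\<close> inside \<open>V\<close>, hence at most that of cut edges.\<close>
  have cut_bound: "(\<Sum>v\<in>Y. \<Sum>u\<in>V. \<delta> v u) \<le> (\<Sum>u\<in>Y. \<Sum>v\<in>V - Y. of_bool (K u v))"
    if Y: "Y \<subseteq> V" for Y
  proof -
    have "(\<Sum>v\<in>Y. \<Sum>u\<in>V. \<delta> v u) = (\<Sum>v\<in>Y. \<Sum>u\<in>V - Y. \<delta> v u)"
      by (rule sum_antisym_cancel[OF finV Y \<delta>_anti])
    also have "\<dots> \<le> (\<Sum>u\<in>Y. \<Sum>v\<in>V - Y. of_bool (adj u v \<and> (u \<in> A \<longleftrightarrow> v \<in> A)))"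
      by (intro sum_mono \<delta>_le)
    also have "\<dots> \<le> (\<Sum>u\<in>Y. \<Sum>v\<in>V - Y. of_bool (adj u v \<and> (u \<in> A \<longleftrightarrow> v \<notin> A)))"
      by (rule A[OF Y])
    also have "\<dots> = (\<Sum>u\<in>Y. \<Sum>v\<in>V - Y. of_bool (K u v))"
      using Y by (intro sum.cong refl) (auto simp: K_def)
    finally show ?thesis .
  qed
  have KV: "u \<in> V \<and> v \<in> V" if "K u v" for u v using that by (simp add: K_def)
  obtain g where g: "unit_flow K g" "\<forall>v\<in>V. (\<Sum>u\<in>V. g v u) = (\<Sum>u\<in>V. \<delta> v u)"
    using unit_flow_with_supply[OF finV K_sym KV total cut_bound] by blast
  note flow = unit_flowD[OF g(1)]
  \<comment> \<open>Undoes the sign flip. As \<open>g\<close> is antisymmetric and joins opposite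
    sides only, \<open>z\<close> is a symmetric change of weights.\<close>
  define z where "z v u = (if v \<in> A then g v u else - g v u)" for v u
  have z_sym: "z u v = z v u" for u v
    using flow(1)[of u v] flow(3)[of u v] flow(3)[of v u] unfolding z_def K_def by (smt (verit))
  have z_sum: "(\<Sum>u\<in>V. z v u) = (\<Sum>u\<in>V. s v u - s u v)" if v: "v \<in> V" for v
  proof (cases "v \<in> A")
    case True
    then show ?thesis using g(2) v by (simp add: z_def \<delta>_def)
  next
    case False
    then have "(\<Sum>u\<in>V. z v u) = - (\<Sum>u\<in>V. g v u)" by (simp add: z_def sum_negf)
    also have "\<dots> = (\<Sum>u\<in>V. - \<delta> v u)" using g(2) v by (simp add: sum_negf)
    also have "\<dots> = (\<Sum>u\<in>V. s v u - s u v)" using False by (intro sum.cong) (auto simp: \<delta>_def)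
    finally show ?thesis .
  qed
  define W where "W u v = B u v + (s u v + s v u) + z u v" for u v
  have off_V: "s u v = 0 \<and> s v u = 0 \<and> z u v = 0" if "u \<notin> V" for u v
    using s(3)[of u v] s(3)[of v u] flow(3)[of u v] that by (auto simp: z_def K_def)
  \<comment> \<open>The total of \<open>z\<close> trades each \<open>s x v\<close> for a second
    \<open>s v x\<close>, which leaves an even shift.\<close>
  have sum_V: "(\<Sum>x\<in>C. W v x) = c v + 2 * (\<Sum>x\<in>V. s v x)" if v: "v \<in> V" for v
  proof -
    have "(\<Sum>x\<in>C. W v x) = c v + (\<Sum>x\<in>C. s v x + s x v + z v x)"
      by (simp add: W_def c_def sum.distrib add.assoc)
    also have "(\<Sum>x\<in>C. s v x + s x v + z v x) = (\<Sum>x\<in>V. s v x + s x v + z v x)"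
      using V finV off_V[of r v] z_sym[of r v] by (simp add: add.assoc)
    also have "\<dots> = 2 * (\<Sum>x\<in>V. s v x)" using z_sum[OF v] by (simp add: sum.distrib sum_subtractf)
    finally show ?thesis .
  qed
  \<comment> \<open>Shifts and flow stay inside \<open>V\<close>, so \<open>r\<close> keeps the
    degree that the greedy choice avoided.\<close>
  have sum_r: "(\<Sum>x\<in>C. W r x) = c r"
    using off_V[OF V(2)] by (simp add: W_def c_def)
  have near_r: "c r \<noteq> (\<Sum>x\<in>C. W v x)" if "adj r v" for v
  proof -
    have "v \<in> V \<inter> D" using that D by (auto simp: D_def)
    then show ?thesis using s(5)[of v] sum_V[of v] by auto
  qed
  show ?thesis
  proof (intro exI[of _ W] conjI allI impI)
    show "W u v = W v u" for u v using B_sym[of u v] z_sym[of u v] by (simp add: W_def)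
    show "W u v = 0" if "\<not> adj u v" for u v
    proof -
      have "\<not> adj v u" using that adj_sym by blast
      moreover have "s u v = 0" "s v u = 0" using calculation that s(3) N_def by blast+
      moreover have "g u v = 0" using that flow(3) K_def by blast
      ultimately show ?thesis
        using that X(1) by (auto simp: W_def B_def B0_def D_def z_def)
    qed
    show "W u v \<in> {1..4}" if uv: "adj u v" for u v
    proof -
      consider "u = r \<or> v = r" | "N u v" | "K u v"
        using adjC[OF uv] V uv unfolding N_def K_def by blast
      then show ?thesis
      proof cases
        case 1
        then have "s u v = 0" "s v u = 0" "z u v = 0"
          using off_V[OF V(2), of u] off_V[OF V(2), of v] z_sym[of r u] by auto
        then show ?thesis using 1 uv h(2)[of u v] by (auto simp: W_def B_def B0_def)
      next
        case 2
        then have "z u v = 0" using flow(3)[of u v] by (auto simp: z_def N_def K_def)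
        moreover have "B u v = 2 + h u v" using 2 V uv by (auto simp: B_def B0_def N_def)
        ultimately show ?thesis using s(1)[of u v] s(1)[of v u] s(2)[of u v] h(2)[of u v]
          by (auto simp: W_def)
      next
        case 3
        then have "s u v = 0" "s v u = 0" using s(3)[of u v] s(3)[of v u] by (auto simp: N_def K_def)
        moreover have "B u v = 2 + h u v" using 3 V uv by (auto simp: B_def B0_def K_def)
        moreover have "\<bar>z u v\<bar> \<le> 1" using flow(2)[of u v] by (simp add: z_def)
        ultimately show ?thesis using h(2)[of u v] by (auto simp: W_def)
      qed
    qed
    show "(\<Sum>x\<in>C. W u x) \<noteq> (\<Sum>x\<in>C. W v x)" if uv: "adj u v" for u v
    proof -
      consider "u = r" | "v = r" | "N u v" | "K u v"
        using adjC[OF uv] V uv unfolding N_def K_def by blast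
      then show ?thesis
      proof cases
        case 1
        then show ?thesis using near_r[of v] sum_r uv by simp
      next
        case 2
        then show ?thesis using near_r[of u] sum_r uv adj_sym[of u v] by auto
      next
        case 3
        then have "u \<in> V" "v \<in> V" by (auto simp: N_def)
        then show ?thesis using s(4)[of u v] 3 sum_V by simp
      next
        case 4
        then have "u \<in> V" "v \<in> V" "u \<in> A \<longleftrightarrow> v \<notin> A" by (auto simp: K_def)
        then have "odd (c u) \<noteq> odd (c v)" using c_parity by blast
        then show ?thesis unfolding sum_V[OF \<open>u \<in> V\<close>] sum_V[OF \<open>v \<in> V\<close>] by presburger
      qed
    qed
  qed
qed

section \<open>From components to the whole graph\<close>

text \<open>Only \<open>u\<close> and \<open>v\<close> are reachable from \<open>u\<close>, so they
  span a component. The contrapositive supplies \<open>no_K2\<close> for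
  \<open>weighting_connected\<close>.\<close>

lemma K2_component:
  assumes "pair_graph G" and uv: "(u, v) \<in> parcs G"
    and nbs: "\<And>w. (u, w) \<in> parcs G \<Longrightarrow> w = v" "\<And>w. (v, w) \<in> parcs G \<Longrightarrow> w = u"
  shows "\<exists>C\<in>components G. digraph_iso C (with_proj K2)"
proof -
  interpret pair_graph G by fact
  let ?C = "with_proj G \<restriction> {u, v}"
  have vu: "(v, u) \<in> parcs G" using uv by (rule arcs_symmetric)
  have verts: "u \<in> pverts G" "v \<in> pverts G" using uv by (auto dest: wellformed')
  have neq: "u \<noteq> v" using pair_no_loops[OF uv] by simp
  have "w = u \<or> w = v" if "u \<rightarrow>\<^sup>*\<^bsub>with_proj G\<^esub> w" for w
    using that unfolding reachable_def by (induction rule: rtrancl_on_induct) (auto dest: nbs)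
  moreover have "u \<rightarrow>\<^sup>*\<^bsub>with_proj G\<^esub> u" "u \<rightarrow>\<^sup>*\<^bsub>with_proj G\<^esub> v"
    using verts uv unfolding reachable_def by (auto intro: rtrancl_on_into_rtrancl_on)
  ultimately have "{w. u \<rightarrow>\<^sup>*\<^bsub>with_proj G\<^esub> w} = {u, v}" by blast
  then have C: "?C \<in> components G" using induce_reachable_is_in_sccs[of u] verts by simp
  have "(u, u) \<notin> parcs G" "(v, v) \<notin> parcs G" using pair_no_loops by force+
  then have arcs: "arcs ?C = {(u, v), (v, u)}" using uv vu by auto
  define f where "f x = (if x = u then 0 else (1 :: nat))" for x
  define iso where "iso = \<lparr>iso_verts = f, iso_arcs = map_prod f f, iso_head = snd, iso_tail = fst\<rparr>"
  have "wf_digraph ?C" by (rule wellformed_induce_subgraph)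
  then have "pre_digraph.digraph_isomorphism ?C iso"
    using neq unfolding pre_digraph.digraph_isomorphism_def arcs
    by (auto simp: iso_def f_def)
  moreover have "with_proj K2 = app_iso iso ?C"
    unfolding app_iso_def arcs using neq by (auto simp: iso_def f_def with_proj_def K2_def)
  ultimately show ?thesis using C unfolding digraph_iso_def by blast
qed

theorem theorem1:
  fixes G :: "'a pair_pre_digraph"
  assumes "pair_graph G"
    and "\<not> (\<exists>C \<in> components G. digraph_iso C (with_proj K2))"
  shows "\<exists>\<omega> :: 'a set \<Rightarrow> nat. \<omega> \<in> edges G \<rightarrow> {1, 2, 3, 4} \<and>
    (\<forall>u v. (u, v) \<in> parcs G \<longrightarrow>
      (\<Sum>w \<in> neighborhood G u. \<omega> {u, w}) \<noteq> (\<Sum>w \<in> neighborhood G v. \<omega> {v, w}))"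
proof -
  interpret pair_graph G by fact
  define adj where "adj u v \<longleftrightarrow> (u, v) \<in> parcs G" for u v
  have adj_sym: "adj v u" if "adj u v" for u v using that arcs_symmetric by (simp add: adj_def)
  define comp where "comp v = {u. adj\<^sup>*\<^sup>* u v}" for v
  \<comment> \<open>The conclusion of \<open>weighting_connected\<close> for adjacency cut down to
    \<open>C\<close>. Testing \<open>u\<close> alone is enough, as a component contains both ends of
    its edges.\<close>
  define good where "good C W \<longleftrightarrow> (\<forall>u v. W u v = W v u) \<and> (\<forall>u v. u \<in> C \<and> adj u v \<longrightarrow> W u v \<in> {1..4})
    \<and> (\<forall>u v. \<not> (u \<in> C \<and> adj u v) \<longrightarrow> W u v = 0)
    \<and> (\<forall>u v. u \<in> C \<and> adj u v \<longrightarrow> (\<Sum>x\<in>C. W u x) \<noteq> (\<Sum>x\<in>C. W v x))"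
    for C and W :: "'a \<Rightarrow> 'a \<Rightarrow> int"
  have comp_closed: "v \<in> comp r" if "u \<in> comp r" "adj u v" for r u v
    using that adj_sym unfolding comp_def by (auto intro: converse_rtranclp_into_rtranclp)
  have comp_eq: "comp u = comp v" if "adj u v" for u v
    using that adj_sym[OF that] unfolding comp_def by (auto intro: rtranclp.rtrancl_into_rtrancl)
  have ex_good: "\<exists>W. good (comp r) W" if r: "r \<in> pverts G" for r
  proof -
    let ?adj = "\<lambda>u v. u \<in> comp r \<and> adj u v"
    have "v \<in> pverts G" if "adj\<^sup>*\<^sup>* v r" for v
      using that by (induction rule: converse_rtranclp_induct) (auto simp: r adj_def dest: wellformed')
    then have "comp r \<subseteq> pverts G" by (auto simp: comp_def)
    then have "finite (comp r)" using pair_finite_verts by (rule finite_subset)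
    moreover have "symp ?adj" using comp_closed adj_sym by (auto intro!: sympI)
    moreover have "irreflp ?adj" using pair_no_loops by (force simp: adj_def intro!: irreflpI)
    moreover have "u \<in> comp r \<and> v \<in> comp r" if "?adj u v" for u v using that comp_closed by blast
    moreover have "r \<in> comp r" by (simp add: comp_def)
    moreover have "?adj\<^sup>*\<^sup>* v r" if "v \<in> comp r" for v
    proof -
      from that have "adj\<^sup>*\<^sup>* v r" by (simp add: comp_def)
      then show ?thesis
      proof (induction rule: converse_rtranclp_induct)
        case (step x y)
        then have "?adj x y" by (auto simp: comp_def intro: converse_rtranclp_into_rtranclp)
        then show ?case using step.IH by (rule converse_rtranclp_into_rtranclp)
      qed simp
    qed
    moreover have "\<exists>w. ?adj u w \<and> w \<noteq> v \<or> ?adj v w \<and> w \<noteq> u" if "?adj u v" for u v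
      using K2_component[OF assms(1), of u v] assms(2) that comp_closed unfolding adj_def by blast
    ultimately show ?thesis unfolding good_def by (rule weighting_connected)
  qed
  \<comment> \<open>The choice depends only on the set \<open>comp u\<close>, so by
    \<open>comp_eq\<close> adjacent vertices consult the same function.\<close>
  define W where "W u = (SOME W. good (comp u) W) u" for u
  have good: "good (comp u) (SOME W. good (comp u) W)" if "u \<in> pverts G" for u
    using someI_ex[OF ex_good[OF that]] .
  have verts: "u \<in> pverts G" "v \<in> pverts G" if "adj u v" for u v
    using that by (auto simp: adj_def dest: wellformed')
  have self: "u \<in> comp u" for u by (simp add: comp_def)
  have W_sym: "W u v = W v u" if "adj u v" for u v
    using good[OF verts(1)[OF that]] unfolding W_def comp_eq[OF that, symmetric] good_def by blast
  have W_range: "W u v \<in> {1..4}" if "adj u v" for u v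
    using good[OF verts(1)[OF that]] that self[of u] unfolding W_def good_def by blast
  have W_zero: "W u v = 0" if "u \<in> pverts G" "\<not> adj u v" for u v
    using good[OF that(1)] that(2) unfolding W_def good_def by blast
  have W_sum: "(\<Sum>x\<in>comp u. W u x) = (\<Sum>x\<in>neighborhood G u. W u x)" if "u \<in> pverts G" for u
  proof (rule sum.mono_neutral_right)
    have "v \<in> pverts G" if "adj\<^sup>*\<^sup>* v u" for v
      using that \<open>u \<in> pverts G\<close>
      by (induction rule: converse_rtranclp_induct) (auto simp: adj_def dest: wellformed')
    then have "comp u \<subseteq> pverts G" by (auto simp: comp_def)
    then show "finite (comp u)" using pair_finite_verts by (rule finite_subset)
    show "neighborhood G u \<subseteq> comp u"
      using comp_closed[OF self] by (auto simp: neighborhood_def adj_def)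
    show "\<forall>x\<in>comp u - neighborhood G u. W u x = 0"
      using W_zero[OF that] by (simp add: neighborhood_def adj_def)
  qed
  have W_neq: "(\<Sum>x\<in>neighborhood G u. W u x) \<noteq> (\<Sum>x\<in>neighborhood G v. W v x)" if "adj u v" for u v
  proof -
    have "(\<Sum>x\<in>comp u. W u x) \<noteq> (\<Sum>x\<in>comp u. W v x)"
      using good[OF verts(1)[OF that]] that self[of u]
      unfolding W_def comp_eq[OF that, symmetric] good_def by blast
    then show ?thesis using W_sum[OF verts(1)[OF that]] W_sum[OF verts(2)[OF that]] comp_eq[OF that] by simp
  qed
  \<comment> \<open>An orientation of the edge \<open>e\<close> is picked arbitrarily; the symmetry
    of \<open>W\<close> makes the value independent of it.\<close>
  define \<omega> where "\<omega> e = nat (case SOME p. p \<in> parcs G \<and> e = {fst p, snd p} of (u, v) \<Rightarrow> W u v)" for e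
  have \<omega>: "\<omega> {u, v} = nat (W u v)" if "adj u v" for u v
  proof -
    define p where "p = (SOME p. p \<in> parcs G \<and> {u, v} = {fst p, snd p})"
    have "p \<in> parcs G \<and> {u, v} = {fst p, snd p}"
      unfolding p_def
      by (rule someI[where x = "(u, v)"]) (use that in \<open>simp add: adj_def\<close>)
    then have "p = (u, v) \<or> p = (v, u)" by (cases p) (auto simp: doubleton_eq_iff)
    moreover have "\<omega> {u, v} = nat (case p of (u, v) \<Rightarrow> W u v)" by (simp add: \<omega>_def p_def)
    ultimately show ?thesis using W_sym[OF that] by (elim disjE) simp_all
  qed
  have \<omega>_sum: "int (\<Sum>w\<in>neighborhood G u. \<omega> {u, w}) = (\<Sum>w\<in>neighborhood G u. W u w)" for u
    using W_range by (force simp: neighborhood_def \<omega> adj_def intro!: sum.cong)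
  show ?thesis
  proof (intro exI[of _ \<omega>] conjI allI impI)
    show "\<omega> \<in> edges G \<rightarrow> {1, 2, 3, 4}"
    proof
      fix e assume "e \<in> edges G"
      then obtain u v where "adj u v" "e = {u, v}" by (auto simp: edges_def adj_def)
      then show "\<omega> e \<in> {1, 2, 3, 4}" using \<omega>[of u v] W_range[of u v] by auto
    qed
    show "(\<Sum>w\<in>neighborhood G u. \<omega> {u, w}) \<noteq> (\<Sum>w\<in>neighborhood G v. \<omega> {v, w})"
      if "(u, v) \<in> parcs G" for u v
      using W_neq[of u v] that unfolding adj_def \<omega>_sum[symmetric] by metis
  qed
qed

end
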